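(* Let $k \geq 3$ be an integer and let $n = 2^k + 7k$. Then there exists a function $f : \mathbb{F}_2^n \to \{-1,1\}$ such that, writing $\mathcal{S} = \mathrm{supp}(\widehat{f})$, we have $|\mathcal{S}| \geq 2^{6k}$, and yet for all distinct $\gamma_1, \gamma_2 \in \mathbb{F}_2^n$, \[ |(\mathcal{S} + \gamma_1) \cap (\mathcal{S} + \gamma_2)| \leq 2^{5k+4}. \]
   Context: Every $f : \mathbb{F}_2^n \to \mathbb{R}$ has a unique Fourier expansion $f = \sum_{\alpha \in \mathbb{F}_2^n} \widehat{f}(\alpha)\chi_\alpha$, where $\chi_\alpha(x) = (-1)^{\langle x, \alpha\rangle}$ and $\widehat{f}(\alpha) = \mathbb{E}_{x \in \mathbb{F}_2^n}[f(x)\chi_\alpha(x)]$. The Fourier support is $\mathrm{supp}(\widehat{f}) = \{\alpha \in \mathbb{F}_2^n : \widehat{f}(\alpha) \neq 0\}$. For a set $\mathcal{S} \subseteq \mathbb{F}_2^n$ and $\gamma \in \mathbb{F}_2^n$, $\mathcal{S} + \gamma = \{s + \gamma : s \in \mathcal{S}\}$. *)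

theory Defs
  imports Complex_Main "HOL-Library.Z2" "HOL-Library.FuncSet" "Jordan_Normal_Form.Matrix"
begin

text \<open>
  The space $F_2^n$ is the set \<^term>\<open>carrier_vec n :: bit vec set\<close>, so that the
  dimension is an ordinary natural number. A function on $F_2^n$ is a function on
  \<^typ>\<open>bit vec\<close> of which only the values on this carrier matter.
\<close>

abbreviation F2 :: "nat \<Rightarrow> bit vec set" where
  "F2 n \<equiv> carrier_vec n"

lemma UNIV_bit: "(UNIV :: bit set) = {0, 1}"
  using bit_not_zero_iff by blast

lemma F2_eq_lists: "F2 n = vec_of_list ` {xs. set xs \<subseteq> {0, 1} \<and> length xs = n}"
proof (intro equalityI subsetI)
  fix v assume "v \<in> F2 n"
  then have "v = vec_of_list (list_of_vec v)" "length (list_of_vec v) = n"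
    by (auto simp: vec_list)
  then show "v \<in> vec_of_list ` {xs. set xs \<subseteq> {0, 1} \<and> length xs = n}"
    using UNIV_bit by blast
qed (auto intro: carrier_vecI)

lemma finite_F2: "finite (F2 n)"
  unfolding F2_eq_lists by (intro finite_imageI finite_lists_length_eq) simp

lemma card_F2: "card (F2 n) = 2 ^ n"
proof -
  have "inj_on vec_of_list {xs :: bit list. set xs \<subseteq> {0, 1} \<and> length xs = n}"
    by (rule inj_on_inverseI[where g = list_of_vec]) (simp add: list_vec)
  then show ?thesis
    unfolding F2_eq_lists by (simp add: card_image card_lists_length_eq numeral_2_eq_2)
qed

definition chi :: "bit vec \<Rightarrow> bit vec \<Rightarrow> real" where
  "chi \<alpha> x = (- 1) ^ (of_bit (x \<bullet> \<alpha>) :: nat)"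

definition fourier_coeff :: "nat \<Rightarrow> (bit vec \<Rightarrow> real) \<Rightarrow> bit vec \<Rightarrow> real" where
  "fourier_coeff n f \<alpha> = (\<Sum>x\<in>F2 n. f x * chi \<alpha> x) / real (card (F2 n))"

definition fourier_supp :: "nat \<Rightarrow> (bit vec \<Rightarrow> real) \<Rightarrow> bit vec set" where
  "fourier_supp n f = {\<alpha> \<in> F2 n. fourier_coeff n f \<alpha> \<noteq> 0}"

definition translate :: "bit vec set \<Rightarrow> bit vec \<Rightarrow> bit vec set" where
  "translate S \<gamma> = {s + \<gamma> | s. s \<in> S}"

end

theory Submission
  imports Defs "HOL-Computational_Algebra.Squarefree"
    "Berlekamp_Zassenhaus.Distinct_Degree_Factorization"
begin

text \<open>
  Let \<open>s = 3k\<close> and identify $F_2^s$ with the field $F_2[X]/(P)$, \<open>P\<close> irreducible of degree \<open>s\<close>.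
  For \<open>t\<close> in $F_2^k$, read as a polynomial of degree below \<open>k\<close>, put \<open>B t c = X t c mod P\<close>. Both
  \<open>1 + X t\<close> and, for \<open>t \<noteq> 0\<close>, \<open>X t\<close> are units modulo \<open>P\<close>. Hence the affine subspaces
  \<open>{(t, c + B t c) | t}\<close>, indexed by \<open>c\<close>, partition $F_2^{k+s}$. Let \<open>f\<close> be the function of
  \<open>(t, z, y, w)\<close> which, on the piece with index \<open>c\<close>, is the character \<open>(-1)^(c \<bullet> y)\<close>; the $2^k$
  coordinates of \<open>w\<close> are dummies.

  Define \<open>\<beta>\<close> by \<open>B t c \<bullet> z = t \<bullet> \<beta> c z\<close>. The Fourier support of \<open>f\<close> is the set of all
  \<open>(\<beta> c z, z, c, 0)\<close>, of size $2^{2s}$. Two distinct translates meet in at most as many points as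
  there are solutions \<open>(c, z)\<close> of an equation \<open>\<beta> c dz + \<beta> dc z = a\<close> with \<open>(dc, dz) \<noteq> 0\<close>. Its
  left-hand side is linear and onto $F_2^k$ by nonsingularity of \<open>B\<close>, which leaves $2^{2s-k} = 2^{5k}$ solutions.
\<close>

section \<open>Irreducible polynomials of every degree\<close>

text \<open>Every prime occurs in \<open>a\<close> at most once, so comparing multiplicities only
  requires that it occurs in \<open>b\<close> at all.\<close>

lemma squarefree_dvd_if_prime_factors_dvd:
  fixes a b :: "'a :: factorial_semiring"
  assumes "squarefree a" and "b \<noteq> 0" and "\<And>p. prime p \<Longrightarrow> p dvd a \<Longrightarrow> p dvd b"
  shows "a dvd b"
proof (rule multiplicity_le_imp_dvd)
  show "a \<noteq> 0" using assms(1) by auto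
  show "multiplicity p a \<le> multiplicity p b" if "prime p" for p
  proof (cases "p dvd a")
    case True
    then have "multiplicity p b > 0"
      using assms that by (simp add: prime_multiplicity_gt_zero_iff)
    moreover have "multiplicity p a \<le> 1"
      using assms(1) that \<open>a \<noteq> 0\<close> by (simp add: squarefree_factorial_semiring'')
    ultimately show ?thesis by simp
  qed (simp add: not_dvd_imp_multiplicity_0)
qed

text \<open>By the product rule, a factor whose square divides \<open>f\<close> also divides
  \<open>pderiv f\<close>.\<close>

lemma squarefree_if_pderiv_unit:
  fixes f :: "'a :: field poly"
  assumes "is_unit (pderiv f)"
  shows "squarefree f"
proof (rule squarefreeI)
  fix x assume "x\<^sup>2 dvd f"
  then obtain g where "f = x * (x * g)" by (metis dvdE mult.assoc power2_eq_square)
  then have "x dvd pderiv f" by (simp add: pderiv_mult)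
  then show "x dvd 1" using assms dvd_trans by blast
qed

text \<open>
  Otherwise every irreducible factor of the squarefree polynomial $X^{q^d} - X$ has some degree
  $e < d$, so it divides $X^{q^e} - X$. Then $X^{q^d} - X$ divides the product of these polynomials
  over \<open>1 \<le> e < d\<close>, whose degree is too small.
\<close>

lemma exists_irreducible_mod_ring_poly:
  assumes "d \<ge> 1"
  shows "\<exists>P :: 'a :: prime_card mod_ring poly. irreducible P \<and> degree P = d"
proof (rule ccontr)
  assume none: "\<not> ?thesis"
  define q where "q = CARD('a)"
  have q: "q \<ge> 2" using prime_ge_2_nat prime_card unfolding q_def by blast
  define F :: "nat \<Rightarrow> 'a mod_ring poly" where "F e = monom 1 1 ^ (q ^ e) - monom 1 1" for e
  have q_gt: "q ^ e \<ge> 2" if "e \<ge> 1" for e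
    using q power_increasing[OF that, of q] by simp
  have deg: "degree (F e) = q ^ e" if "e \<ge> 1" for e
    using q_gt[OF that] unfolding F_def x_pow_n diff_conv_add_uminus
    by (subst degree_add_eq_left) (auto simp: degree_monom_eq)
  have nz: "F e \<noteq> 0" if "e \<ge> 1" for e
    using deg[OF that] q by (metis degree_0 not_numeral_le_zero power_not_zero)
  \<comment> \<open>The leading term differentiates to zero because its exponent
    \<open>q ^ d\<close> vanishes in characteristic \<open>q\<close>.\<close>
  have "pderiv (F d) = - 1"
  proof -
    have "(of_nat (q ^ d) :: 'a mod_ring) = 0"
      using assms by (simp add: q_def of_nat_card_eq_0)
    then show ?thesis unfolding F_def x_pow_n by (simp add: pderiv_diff pderiv_monom)
  qed
  then have "squarefree (F d)" by (intro squarefree_if_pderiv_unit) simp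
  moreover have "(\<Prod>e\<in>{1..<d}. F e) \<noteq> 0" using nz by auto
  moreover have "p dvd (\<Prod>e\<in>{1..<d}. F e)" if p: "prime p" "p dvd F d" for p
  proof -
    have irr: "irreducible p" using p(1) by auto
    have "degree p \<ge> 1"
      using irr irreducible_def is_unit_iff_degree by (metis less_one linorder_not_le)
    moreover have "\<not> degree p > d"
      using degree_divisor(2)[OF irr refl assms] p(2) by (auto simp: F_def q_def)
    moreover have "degree p \<noteq> d" using none irr by auto
    ultimately have "degree p \<in> {1..<d}" by auto
    moreover have "p dvd F (degree p)"
      using degree_divisor(1)[OF irr refl] by (simp add: F_def q_def)
    ultimately show ?thesis by (meson dvd_prodI dvd_trans finite_atLeastLessThan)
  qed
  ultimately have "F d dvd (\<Prod>e\<in>{1..<d}. F e)"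
    by (rule squarefree_dvd_if_prime_factors_dvd)
  then have "degree (F d) \<le> degree (\<Prod>e\<in>{1..<d}. F e)"
    using nz by (intro dvd_imp_degree_le) auto
  also have "\<dots> = (\<Sum>e\<in>{1..<d}. q ^ e)"
    using nz deg by (subst degree_prod_eq_sum_degree) auto
  \<comment> \<open>Including e = 0 gives a full geometric sum, for which the induction can start at
    the empty sum.\<close>
  also have "\<dots> \<le> (\<Sum>e<d. q ^ e)" by (rule sum_mono2) auto
  also have "\<dots> < q ^ d"
  proof (induction d)
    case (Suc d)
    then have "(\<Sum>e<Suc d. q ^ e) < 2 * q ^ d" by simp
    also have "\<dots> \<le> q ^ Suc d" using q by simp
    finally show ?case .
  qed simp
  finally show False using deg[OF assms] q_gt[OF assms] by simp
qed

text \<open>A factorization of the image pulls back along \<open>g\<close>, and neither map changes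
  degrees, which decide what is a unit. This transports irreducible polynomials between two models
  of the same field.\<close>

lemma irreducible_map_poly:
  fixes h :: "'a :: field \<Rightarrow> 'b :: field" and g :: "'b \<Rightarrow> 'a"
  assumes "field_hom h" "field_hom g" and inv: "\<And>x. g (h x) = x" "\<And>y. h (g y) = y"
    and irr: "irreducible p"
  shows "irreducible (map_poly h p)"
proof -
  interpret h: field_hom h by fact
  interpret g: field_hom g by fact
  interpret H: map_poly_inj_idom_hom h ..
  interpret G: map_poly_inj_idom_hom g ..
  have gh: "map_poly g (map_poly h u) = u" for u by (simp add: map_poly_map_poly o_def inv)
  show ?thesis
  proof (rule irreducibleI)
    show "map_poly h p \<noteq> 0" using irr by auto
    show "\<not> is_unit (map_poly h p)"
      using irr by (auto simp: is_unit_iff_degree irreducible_def)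
    fix a b assume ab: "map_poly h p = a * b"
    then have nz: "a \<noteq> 0" "b \<noteq> 0" using irr by auto
    have "p = map_poly g a * map_poly g b" using ab gh[of p] by (simp add: G.hom_mult)
    then have "is_unit (map_poly g a) \<or> is_unit (map_poly g b)" using irr irreducibleD by blast
    then show "is_unit a \<or> is_unit b" using nz by (simp add: is_unit_iff_degree)
  qed
qed

text \<open>The type \<open>bool mod_ring\<close> is the field with \<open>CARD(bool)\<close> = 2
  elements, hence isomorphic to \<open>bit\<close>; \<open>h\<close> and \<open>g\<close> are the
  two directions of the isomorphism.\<close>

lemma exists_irreducible_bit_poly:
  assumes "d \<ge> 1"
  shows "\<exists>P :: bit poly. irreducible P \<and> degree P = d"
proof -
  define h :: "bool mod_ring \<Rightarrow> bit" where "h x = (if x = 0 then 0 else 1)" for x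
  define g :: "bit \<Rightarrow> bool mod_ring" where "g x = (if x = 0 then 0 else 1)" for x
  have cases2: "x = 0 \<or> x = 1" for x :: "bool mod_ring"
    using surj_of_nat_mod_ring[of x] unfolding card_UNIV_bool less_2_cases_iff by fastforce
  have two: "1 + 1 = (0 :: bool mod_ring)"
    using of_nat_card_eq_0[where ?'a = bool] by (simp add: numeral_2_eq_2)
  have h_add: "h (x + y) = h x + h y" for x y
    using cases2[of x] cases2[of y] two by (auto simp: h_def)
  have h_mult: "h (x * y) = h x * h y" for x y
    by (auto simp: h_def)
  have h01: "h 0 = 0" "h 1 = 1" by (auto simp: h_def)
  have g_add: "g (x + y) = g x + g y" for x y
    using two by (cases x; cases y) (auto simp: g_def)
  have g_mult: "g (x * y) = g x * g y" for x y
    by (cases x; cases y) (auto simp: g_def)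
  have g01: "g 0 = 0" "g 1 = 1" by (auto simp: g_def)
  have hom: "field_hom h" "field_hom g"
    by (unfold_locales; fact h_add h_mult h01 g_add g_mult g01)+
  have inv: "g (h x) = x" "h (g y) = y" for x y
    using cases2[of x] by (auto simp: g_def h_def)
  obtain P :: "bool mod_ring poly" where P: "irreducible P" "degree P = d"
    using exists_irreducible_mod_ring_poly[OF assms] by blast
  interpret h: field_hom h by (rule hom)
  have "degree (map_poly h P) = d" using P by simp
  with irreducible_map_poly[OF hom inv P(1)] show ?thesis by blast
qed

section \<open>Characters of $F_2^n$\<close>

definition bsign :: "bit \<Rightarrow> real" where
  "bsign b = (- 1) ^ (of_bit b :: nat)"

lemma bsign_simps [simp]: "bsign 0 = 1" "bsign 1 = -1"
  by (simp_all add: bsign_def)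

lemma bsign_add: "bsign (a + b) = bsign a * bsign b"
  by (cases a; cases b) simp_all

lemma bit_add_eq_0_iff: "a + b = 0 \<longleftrightarrow> a = b" for a b :: bit
  by (cases a; cases b) simp_all

lemma bsign_range: "bsign b \<in> {-1, 1}"
  by (cases b) simp_all

lemma chi_eq_bsign: "chi \<alpha> x = bsign (x \<bullet> \<alpha>)"
  by (simp add: chi_def bsign_def)

lemma F2_add_self: "x \<in> F2 n \<Longrightarrow> x + x = 0\<^sub>v n"
  by (intro eq_vecI) auto

lemma F2_add_left_cancel: "x \<in> F2 n \<Longrightarrow> y \<in> F2 n \<Longrightarrow> x + (x + y) = y"
  by (simp add: F2_add_self flip: assoc_add_vec)

lemma F2_add_right_cancel: "x \<in> F2 n \<Longrightarrow> y \<in> F2 n \<Longrightarrow> y + x + x = y"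
  by (simp add: F2_add_self)

lemma F2_add_eq_0_iff: "x \<in> F2 n \<Longrightarrow> y \<in> F2 n \<Longrightarrow> x + y = 0\<^sub>v n \<longleftrightarrow> x = y"
  by (metis F2_add_left_cancel F2_add_self right_zero_vec)

lemma F2_add_eq_addD:
  assumes "x + a = y + b" "x \<in> F2 n" "a \<in> F2 n" "y \<in> F2 n" "b \<in> F2 n"
  shows "y = x + (a + b)"
proof -
  have "y = x + a + b" unfolding assms(1) using F2_add_right_cancel[OF assms(5,4)] by (rule sym)
  then show ?thesis using assms(2-) by simp
qed

text \<open>A coordinatewise check in characteristic 2. The shape of the equation is that of the
  first block when two translates are compared.\<close>

lemma F2_add_solve:
  assumes "x + a = x + v + w + b" "x \<in> F2 n" "a \<in> F2 n" "v \<in> F2 n" "w \<in> F2 n" "b \<in> F2 n"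
  shows "v = a + b + w"
proof (rule eq_vecI)
  fix i assume "i < dim_vec (a + b + w)"
  then have i: "i < n" using assms(5) by simp
  then have "x $ i + a $ i = x $ i + v $ i + w $ i + b $ i"
    using assms(2-) arg_cong[OF assms(1), of "\<lambda>u. u $ i"]
    by (simp add: add.assoc del: add_bit_eq_xor)
  then have "v $ i = a $ i + b $ i + w $ i"
    by (cases "x $ i"; cases "v $ i"; cases "w $ i"; cases "a $ i"; cases "b $ i") simp_all
  then show "v $ i = (a + b + w) $ i" using assms(2-) i by (simp add: add.assoc del: add_bit_eq_xor)
qed (use assms in auto)

lemma bij_betw_F2_translate: "a \<in> F2 n \<Longrightarrow> bij_betw (\<lambda>x. x + a) (F2 n) (F2 n)"
  by (rule bij_betw_byWitness[where f' = "\<lambda>x. x + a"]) (auto simp: F2_add_right_cancel)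

text \<open>Orthogonality of characters: translating by a point where \<open>g\<close> is 1 permutes
  the summands and flips the sign of the sum. Only additivity is assumed, so that it also applies to
  functionals such as \<open>B t c \<bullet> dz\<close> in \<open>c\<close>.\<close>

lemma sum_bsign_additive:
  assumes add: "\<And>x y. x \<in> F2 n \<Longrightarrow> y \<in> F2 n \<Longrightarrow> g (x + y) = g x + g y"
  shows "(\<Sum>x\<in>F2 n. bsign (g x)) = (if \<forall>x\<in>F2 n. g x = 0 then 2 ^ n else 0)"
proof (cases "\<forall>x\<in>F2 n. g x = 0")
  case True
  then show ?thesis by (simp add: card_F2)
next
  case False
  then obtain a where a: "a \<in> F2 n" "g a = 1" by (auto simp: bit_not_zero_iff)
  have "(\<Sum>x\<in>F2 n. bsign (g x)) = (\<Sum>x\<in>F2 n. bsign (g (x + a)))"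
    by (rule sum.reindex_bij_betw[OF bij_betw_F2_translate[OF a(1)], symmetric])
  also have "\<dots> = - (\<Sum>x\<in>F2 n. bsign (g x))"
    using a by (simp add: add bsign_add sum_negf del: add_bit_eq_xor)
  finally show ?thesis using False by simp
qed

lemma F2_eq_0_iff_orthogonal:
  assumes "a \<in> F2 n"
  shows "(\<forall>x\<in>F2 n. x \<bullet> a = 0) \<longleftrightarrow> a = 0\<^sub>v n"
proof
  assume *: "\<forall>x\<in>F2 n. x \<bullet> a = 0"
  show "a = 0\<^sub>v n"
  proof (rule eq_vecI)
    fix i assume "i < dim_vec (0\<^sub>v n :: bit vec)"
    then have "i < n" by simp
    then have "a $ i = unit_vec n i \<bullet> a" using assms by simp
    then show "a $ i = 0\<^sub>v n $ i" using * \<open>i < n\<close> by simp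
  qed (use assms in simp)
qed auto

lemma F2_eqI_scalar_prod:
  assumes "a \<in> F2 n" "b \<in> F2 n" and "\<And>x. x \<in> F2 n \<Longrightarrow> x \<bullet> a = x \<bullet> b"
  shows "a = b"
proof -
  have "\<forall>x\<in>F2 n. x \<bullet> (a + b) = 0"
    using assms by (simp add: scalar_prod_add_distrib[of _ n])
  then show ?thesis using F2_eq_0_iff_orthogonal F2_add_eq_0_iff assms by (metis add_carrier_vec)
qed

lemma sum_bsign_scalar_prod:
  assumes "a \<in> F2 n"
  shows "(\<Sum>x\<in>F2 n. bsign (x \<bullet> a)) = (if a = 0\<^sub>v n then 2 ^ n else 0)"
proof -
  have "(x + y) \<bullet> a = x \<bullet> a + y \<bullet> a" if "x \<in> F2 n" "y \<in> F2 n" for x y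
    using that assms by (rule add_scalar_prod_distrib)
  from sum_bsign_additive[of n "\<lambda>x. x \<bullet> a", OF this] show ?thesis
    using F2_eq_0_iff_orthogonal[OF assms] by simp
qed

text \<open>If no vector represented \<open>g\<close>, every Fourier coefficient of \<open>bsign \<circ> g\<close> would vanish,
  against Fourier inversion at 0.\<close>

lemma additive_functional_representation:
  assumes add: "\<And>x y. x \<in> F2 n \<Longrightarrow> y \<in> F2 n \<Longrightarrow> g (x + y) = g x + g y"
  shows "\<exists>b\<in>F2 n. \<forall>x\<in>F2 n. g x = x \<bullet> b"
proof (rule ccontr)
  assume none: "\<not> ?thesis"
  have "(\<Sum>x\<in>F2 n. bsign (g x + x \<bullet> b)) = 0" if b: "b \<in> F2 n" for b
  proof -
    have "g (x + y) + (x + y) \<bullet> b = (g x + x \<bullet> b) + (g y + y \<bullet> b)"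
      if "x \<in> F2 n" "y \<in> F2 n" for x y
      using that b
      by (simp add: add add_scalar_prod_distrib[of _ n] algebra_simps del: add_bit_eq_xor)
    note sum_bsign_additive[of n "\<lambda>x. g x + x \<bullet> b", OF this]
    moreover have "\<not> (\<forall>x\<in>F2 n. g x + x \<bullet> b = 0)"
      using none b by (auto simp: bit_add_eq_0_iff simp del: add_bit_eq_xor)
    ultimately show ?thesis by simp
  qed
  then have "0 = (\<Sum>b\<in>F2 n. \<Sum>x\<in>F2 n. bsign (g x + x \<bullet> b))" by simp
  also have "\<dots> = (\<Sum>x\<in>F2 n. bsign (g x) * (\<Sum>b\<in>F2 n. bsign (b \<bullet> x)))"
    by (subst sum.swap)
      (auto simp: bsign_add sum_distrib_left comm_scalar_prod[of _ n] simp del: add_bit_eq_xor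
        intro!: sum.cong)
  also have "\<dots> = (\<Sum>x\<in>F2 n. if x = 0\<^sub>v n then bsign (g x) * 2 ^ n else 0)"
    by (intro sum.cong) (auto simp: sum_bsign_scalar_prod)
  also have "\<dots> = bsign (g (0\<^sub>v n)) * 2 ^ n" by (simp add: finite_F2)
  finally show False using bsign_range[of "g (0\<^sub>v n)"] by auto
qed

section \<open>Splitting vectors into blocks, and addressing functions\<close>

lemma vec_first_append [simp]: "u \<in> carrier_vec p \<Longrightarrow> vec_first (u @\<^sub>v v) p = u"
  by (intro eq_vecI) (auto simp: vec_first_def)

lemma vec_last_append [simp]: "v \<in> carrier_vec q \<Longrightarrow> vec_last (u @\<^sub>v v) q = v"
  by (intro eq_vecI) (auto simp: vec_last_def)

lemma bij_betw_append_vec: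
  "bij_betw (\<lambda>(u, v). u @\<^sub>v v) (carrier_vec p \<times> carrier_vec q) (carrier_vec (p + q))"
  by (rule bij_betw_byWitness[where f' = "\<lambda>x. (vec_first x p, vec_last x q)"]) auto

lemma carrier_vec_addE:
  assumes "x \<in> carrier_vec (p + q)"
  obtains u v where "x = u @\<^sub>v v" "u \<in> carrier_vec p" "v \<in> carrier_vec q"
  using assms by (metis vec_first_carrier vec_first_last_append vec_last_carrier)

lemma sum_F2_append: "(\<Sum>x\<in>F2 (p + q). h x) = (\<Sum>u\<in>F2 p. \<Sum>v\<in>F2 q. h (u @\<^sub>v v))"
  by (simp add: sum.cartesian_product case_prod_beta
      flip: sum.reindex_bij_betw[OF bij_betw_append_vec])

text \<open>A function of Maiorana-McFarland type: the first block of coordinates selects a linear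
  character, which is evaluated on the second block.\<close>

definition addressing :: "nat \<Rightarrow> nat \<Rightarrow> (bit vec \<Rightarrow> bit vec) \<Rightarrow> bit vec \<Rightarrow> real" where
  "addressing p q g x = bsign (g (vec_first x p) \<bullet> vec_last x q)"

text \<open>Summing over the second block first leaves, by orthogonality, only those
  \<open>x\<close> whose selected character is \<eta>.\<close>

lemma fourier_coeff_addressing:
  assumes g: "\<And>x. x \<in> F2 p \<Longrightarrow> g x \<in> F2 q" and \<xi>: "\<xi> \<in> F2 p" and \<eta>: "\<eta> \<in> F2 q"
  shows "fourier_coeff (p + q) (addressing p q g) (\<xi> @\<^sub>v \<eta>)
    = (\<Sum>x | x \<in> F2 p \<and> g x = \<eta>. bsign (x \<bullet> \<xi>)) / 2 ^ p"
proof -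
  have "(\<Sum>x\<in>F2 (p + q). addressing p q g x * chi (\<xi> @\<^sub>v \<eta>) x)
      = (\<Sum>x\<in>F2 p. \<Sum>y\<in>F2 q. bsign (x \<bullet> \<xi>) * bsign (y \<bullet> (g x + \<eta>)))"
    unfolding sum_F2_append
  proof (intro sum.cong refl)
    fix x y assume x: "x \<in> F2 p" and y: "y \<in> F2 q"
    have "g x \<bullet> y = y \<bullet> g x" using g[OF x] y by (rule comm_scalar_prod)
    then show "addressing p q g (x @\<^sub>v y) * chi (\<xi> @\<^sub>v \<eta>) (x @\<^sub>v y)
        = bsign (x \<bullet> \<xi>) * bsign (y \<bullet> (g x + \<eta>))"
      using x y \<xi> \<eta> g[OF x]
      by (simp add: addressing_def chi_eq_bsign scalar_prod_append[OF x y \<xi> \<eta>] bsign_add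
          scalar_prod_add_distrib[of _ q] del: add_bit_eq_xor)
  qed
  also have "\<dots> = (\<Sum>x\<in>F2 p. if g x = \<eta> then 2 ^ q * bsign (x \<bullet> \<xi>) else 0)"
    using g \<eta> by (intro sum.cong)
      (auto simp: sum_bsign_scalar_prod F2_add_eq_0_iff simp flip: sum_distrib_left)
  also have "\<dots> = 2 ^ q * (\<Sum>x | x \<in> F2 p \<and> g x = \<eta>. bsign (x \<bullet> \<xi>))"
    by (simp add: sum.inter_filter[symmetric] finite_F2 sum_distrib_left)
  finally show ?thesis by (simp add: fourier_coeff_def card_F2 power_add)
qed

section \<open>The addressing function of a nonsingular bilinear map\<close>

text \<open>A trivial kernel makes an additive map injective, and an injective self-map of a finite
  set is onto.\<close>

lemma additive_bij_betw:
  assumes "\<And>c. c \<in> F2 n \<Longrightarrow> h c \<in> F2 n"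
    and add: "\<And>c c'. c \<in> F2 n \<Longrightarrow> c' \<in> F2 n \<Longrightarrow> h (c + c') = h c + h c'"
    and ker: "\<And>c. c \<in> F2 n \<Longrightarrow> h c = 0\<^sub>v n \<Longrightarrow> c = 0\<^sub>v n"
  shows "bij_betw h (F2 n) (F2 n)"
proof -
  have "inj_on h (F2 n)"
  proof (rule inj_onI)
    fix c c' assume c: "c \<in> F2 n" "c' \<in> F2 n" "h c = h c'"
    then have "h (c + c') = 0\<^sub>v n" using assms by (simp add: F2_add_self)
    then show "c = c'" using ker c by (metis F2_add_eq_0_iff add_carrier_vec)
  qed
  moreover have "h ` F2 n \<subseteq> F2 n" using assms(1) by auto
  ultimately show ?thesis
    by (simp add: bij_betw_def endo_inj_surj finite_F2)
qed

text \<open>What the argument uses of the product X t c mod P: \<open>B_eq_0\<close> controls the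
  intersections of translates, and \<open>B_fixpoint\<close> makes the pieces indexed by
  \<open>c\<close> a partition.\<close>

locale nonsingular_bilinear =
  fixes r s :: nat and B :: "bit vec \<Rightarrow> bit vec \<Rightarrow> bit vec"
  assumes B_closed: "t \<in> F2 r \<Longrightarrow> c \<in> F2 s \<Longrightarrow> B t c \<in> F2 s"
    and B_add_left: "\<lbrakk>t \<in> F2 r; t' \<in> F2 r; c \<in> F2 s\<rbrakk> \<Longrightarrow> B (t + t') c = B t c + B t' c"
    and B_add_right: "\<lbrakk>t \<in> F2 r; c \<in> F2 s; c' \<in> F2 s\<rbrakk> \<Longrightarrow> B t (c + c') = B t c + B t c'"
    and B_eq_0: "\<lbrakk>t \<in> F2 r; c \<in> F2 s; B t c = 0\<^sub>v s\<rbrakk> \<Longrightarrow> t = 0\<^sub>v r \<or> c = 0\<^sub>v s"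
    and B_fixpoint: "\<lbrakk>t \<in> F2 r; c \<in> F2 s; B t c = c\<rbrakk> \<Longrightarrow> c = 0\<^sub>v s"
begin

lemma B_surj:
  assumes "t \<in> F2 r" "t \<noteq> 0\<^sub>v r" "y \<in> F2 s"
  shows "\<exists>c\<in>F2 s. B t c = y"
proof -
  have "bij_betw (B t) (F2 s) (F2 s)"
    using assms B_eq_0 by (intro additive_bij_betw) (auto simp: B_closed B_add_right)
  then show ?thesis using assms(3) by (metis bij_betw_iff_bijections)
qed

text \<open>In characteristic 2 a kernel element is a fixpoint of \<open>B t\<close>. Bijectivity
  says that each (t, z) lies on exactly one piece (t, c + B t c).\<close>

lemma shear_bij: "t \<in> F2 r \<Longrightarrow> bij_betw (\<lambda>c. c + B t c) (F2 s) (F2 s)"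
proof (rule additive_bij_betw)
  fix c c' assume t: "t \<in> F2 r" and c: "c \<in> F2 s" "c' \<in> F2 s"
  have "B t c \<in> F2 s" "B t c' \<in> F2 s" using t c B_closed by auto
  then show "c + c' + B t (c + c') = c + B t c + (c' + B t c')"
    unfolding B_add_right[OF t c] using c by (intro eq_vecI) (auto simp: algebra_simps simp del: add_bit_eq_xor)
next
  fix c assume t: "t \<in> F2 r" and c: "c \<in> F2 s" "c + B t c = 0\<^sub>v s"
  then have "B t c = c" using F2_add_eq_0_iff[of c s "B t c"] B_closed by simp
  then show "c = 0\<^sub>v s" using B_fixpoint t c by blast
qed (auto simp: B_closed)

section \<open>The adjoint of the bilinear map and its fibres\<close>

text \<open>The transpose of the linear map \<open>\<lambda>t. B t c\<close>, applied to
  \<open>z\<close>. A suitable \<open>b\<close> exists because additive functionals are represented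
  by vectors, and it is unique by \<open>F2_eqI_scalar_prod\<close>.\<close>

definition \<beta> :: "bit vec \<Rightarrow> bit vec \<Rightarrow> bit vec" where
  "\<beta> c z = (SOME b. b \<in> F2 r \<and> (\<forall>t\<in>F2 r. B t c \<bullet> z = t \<bullet> b))"

lemma
  assumes "c \<in> F2 s" "z \<in> F2 s"
  shows \<beta>_closed: "\<beta> c z \<in> F2 r"
    and \<beta>_adjoint: "t \<in> F2 r \<Longrightarrow> t \<bullet> \<beta> c z = B t c \<bullet> z"
proof -
  have "\<exists>b\<in>F2 r. \<forall>t\<in>F2 r. B t c \<bullet> z = t \<bullet> b"
    using assms B_closed
    by (intro additive_functional_representation)
      (auto simp: B_add_left add_scalar_prod_distrib[of _ s] simp del: add_bit_eq_xor)
  then have "\<exists>b. b \<in> F2 r \<and> (\<forall>t\<in>F2 r. B t c \<bullet> z = t \<bullet> b)" by blast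
  from someI_ex[OF this, folded \<beta>_def]
  show "\<beta> c z \<in> F2 r" "t \<in> F2 r \<Longrightarrow> t \<bullet> \<beta> c z = B t c \<bullet> z" by auto
qed

text \<open>Additivity carries over from \<open>B\<close>, since a vector is determined by its
  products with all \<open>t\<close>.\<close>

lemma \<beta>_add_left:
  assumes "c \<in> F2 s" "c' \<in> F2 s" "z \<in> F2 s"
  shows "\<beta> (c + c') z = \<beta> c z + \<beta> c' z"
  using assms B_closed
  by (intro F2_eqI_scalar_prod[of _ r])
    (auto simp: \<beta>_closed \<beta>_adjoint scalar_prod_add_distrib[of _ r] add_scalar_prod_distrib[of _ s]
      B_add_right simp del: add_bit_eq_xor)

lemma \<beta>_add_right:
  assumes "c \<in> F2 s" "z \<in> F2 s" "z' \<in> F2 s"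
  shows "\<beta> c (z + z') = \<beta> c z + \<beta> c z'"
  using assms B_closed
  by (intro F2_eqI_scalar_prod[of _ r])
    (auto simp: \<beta>_closed \<beta>_adjoint scalar_prod_add_distrib[of _ r] scalar_prod_add_distrib[of _ s]
      simp del: add_bit_eq_xor)

text \<open>The cross terms are bracketed because they form the linear expression whose fibres are
  counted next.\<close>

lemma \<beta>_add_add:
  assumes "c \<in> F2 s" "c' \<in> F2 s" "z \<in> F2 s" "z' \<in> F2 s"
  shows "\<beta> (c + c') (z + z') = \<beta> c z + (\<beta> c z' + \<beta> c' z) + \<beta> c' z'"
  using assms \<beta>_closed[of c z] \<beta>_closed[of c' z] \<beta>_closed[of c z'] \<beta>_closed[of c' z']
  by (auto simp: \<beta>_add_left \<beta>_add_right ac_simps intro!: eq_vecI simp del: add_bit_eq_xor)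

lemma \<beta>_zero: "\<beta> (0\<^sub>v s) (0\<^sub>v s) = 0\<^sub>v r"
  using \<beta>_add_left[of "0\<^sub>v s" "0\<^sub>v s" "0\<^sub>v s"] \<beta>_closed[of "0\<^sub>v s" "0\<^sub>v s"]
  by (simp add: F2_add_self)

text \<open>The indicator of the equation is expanded into characters indexed by \<open>t\<close>.
  The sum over (c, z) then factors, and for each nonzero \<open>t\<close> one of the factors
  vanishes by nonsingularity, so only \<open>t = 0\<close> contributes.\<close>

lemma card_\<beta>_fibre:
  assumes dc: "dc \<in> F2 s" and dz: "dz \<in> F2 s" and nz: "dc \<noteq> 0\<^sub>v s \<or> dz \<noteq> 0\<^sub>v s" and a: "a \<in> F2 r"
  shows "2 ^ r * card {(c, z) \<in> F2 s \<times> F2 s. \<beta> c dz + \<beta> dc z = a} = 2 ^ (2 * s)"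
proof -
  let ?A = "{(c, z) \<in> F2 s \<times> F2 s. \<beta> c dz + \<beta> dc z = a}"
  have fin: "finite (F2 s \<times> F2 s)" by (simp add: finite_F2)
  have eq: "?A = {p \<in> F2 s \<times> F2 s. \<beta> (fst p) dz + \<beta> dc (snd p) = a}" by auto
  have "2 ^ r * real (card ?A)
      = (\<Sum>p\<in>F2 s \<times> F2 s. if \<beta> (fst p) dz + \<beta> dc (snd p) = a then 2 ^ r else 0)"
    unfolding eq by (simp add: sum.inter_filter[OF fin, symmetric] del: mem_Sigma_iff)
  also have "\<dots> = (\<Sum>p\<in>F2 s \<times> F2 s. \<Sum>t\<in>F2 r. bsign (t \<bullet> (\<beta> (fst p) dz + \<beta> dc (snd p) + a)))"
    using a dc dz by (intro sum.cong refl, subst sum_bsign_scalar_prod)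
      (auto simp: F2_add_eq_0_iff[of _ r] \<beta>_closed)
  also have "\<dots> = (\<Sum>t\<in>F2 r. \<Sum>p\<in>F2 s \<times> F2 s. bsign (t \<bullet> (\<beta> (fst p) dz + \<beta> dc (snd p) + a)))"
    by (rule sum.swap)
  also have "\<dots> = (\<Sum>t\<in>F2 r. bsign (t \<bullet> a) *
      ((\<Sum>c\<in>F2 s. bsign (B t c \<bullet> dz)) * (\<Sum>z\<in>F2 s. bsign (B t dc \<bullet> z))))"
    (is "_ = (\<Sum>t\<in>F2 r. ?g t)")
  proof (rule sum.cong[OF refl])
    fix t assume t: "t \<in> F2 r"
    have "(\<Sum>p\<in>F2 s \<times> F2 s. bsign (t \<bullet> (\<beta> (fst p) dz + \<beta> dc (snd p) + a)))
        = (\<Sum>p\<in>F2 s \<times> F2 s. bsign (t \<bullet> a) * (bsign (B t (fst p) \<bullet> dz) * bsign (B t dc \<bullet> snd p)))"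
      using t a dc dz
      by (intro sum.cong refl)
        (auto simp: \<beta>_closed \<beta>_adjoint scalar_prod_add_distrib[of _ r] bsign_add
          simp del: add_bit_eq_xor)
    also have "\<dots> = ?g t"
      by (simp only: sum_product) (simp only: sum_distrib_left sum.cartesian_product case_prod_beta)
    finally show "(\<Sum>p\<in>F2 s \<times> F2 s. bsign (t \<bullet> (\<beta> (fst p) dz + \<beta> dc (snd p) + a))) = ?g t" .
  qed
  also have "\<dots> = (\<Sum>t\<in>F2 r. if t = 0\<^sub>v r then 2 ^ s * 2 ^ s else 0)"
  proof (rule sum.cong[OF refl])
    fix t assume t: "t \<in> F2 r"
    have add: "B t (c + c') \<bullet> dz = B t c \<bullet> dz + B t c' \<bullet> dz" if "c \<in> F2 s" "c' \<in> F2 s" for c c'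
      using that t dz B_closed by (simp add: B_add_right add_scalar_prod_distrib[of _ s] del: add_bit_eq_xor)
    have add': "B t dc \<bullet> (z + z') = B t dc \<bullet> z + B t dc \<bullet> z'" if "z \<in> F2 s" "z' \<in> F2 s" for z z'
      using that t dc B_closed by (simp add: scalar_prod_add_distrib[of _ s] del: add_bit_eq_xor)
    have sums: "(\<Sum>c\<in>F2 s. bsign (B t c \<bullet> dz)) = (if \<forall>c\<in>F2 s. B t c \<bullet> dz = 0 then 2 ^ s else 0)"
        "(\<Sum>z\<in>F2 s. bsign (B t dc \<bullet> z)) = (if \<forall>z\<in>F2 s. B t dc \<bullet> z = 0 then 2 ^ s else 0)"
      by (rule sum_bsign_additive; fact add add')+
    show "?g t = (if t = 0\<^sub>v r then 2 ^ s * 2 ^ s else 0)"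
    proof (cases "t = 0\<^sub>v r")
      case True
      have B0: "B (0\<^sub>v r) c = 0\<^sub>v s" if "c \<in> F2 s" for c
        using that B_add_left[of "0\<^sub>v r" "0\<^sub>v r" c] B_closed[of "0\<^sub>v r" c] by (simp add: F2_add_self)
      show ?thesis unfolding sums using True a dc dz B0 by (auto simp: card_F2)
    next
      case False
      consider "dz \<noteq> 0\<^sub>v s" | "dc \<noteq> 0\<^sub>v s" using nz by blast
      then show ?thesis
      proof cases
        \<comment> \<open>Since \<open>B t\<close> is onto, \<open>dz\<close> cannot be orthogonal
          to all its values unless it is zero.\<close>
        case 1
        then have "\<not> (\<forall>c\<in>F2 s. B t c \<bullet> dz = 0)"
          using F2_eq_0_iff_orthogonal[OF dz] B_surj[OF t False] by metis
        then have "(\<Sum>c\<in>F2 s. bsign (B t c \<bullet> dz)) = 0" unfolding sums(1) by (rule if_not_P)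
        then show ?thesis using False by simp
      next
        case 2
        then have "B t dc \<noteq> 0\<^sub>v s" using B_eq_0[OF t dc] False by blast
        then have "\<not> (\<forall>z\<in>F2 s. B t dc \<bullet> z = 0)"
          using F2_eq_0_iff_orthogonal[OF B_closed[OF t dc]] comm_scalar_prod[OF B_closed[OF t dc]] by metis
        then have "(\<Sum>z\<in>F2 s. bsign (B t dc \<bullet> z)) = 0" unfolding sums(2) by (rule if_not_P)
        then show ?thesis using False by simp
      qed
    qed
  qed
  also have "\<dots> = 2 ^ (2 * s)" by (simp add: finite_F2 mult_2 power_add)
  finally have "real (2 ^ r * card ?A) = real (2 ^ (2 * s))" by simp
  then show ?thesis by (simp only: of_nat_eq_iff)
qed

section \<open>The addressing function of the partition and its Fourier support\<close>

text \<open>The index of the piece containing \<open>x\<close>, found by inverting the shear. The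
  appended zeros make the last \<open>m\<close> coordinates of the second block dummies.\<close>

definition address :: "nat \<Rightarrow> bit vec \<Rightarrow> bit vec" where
  "address m x = inv_into (F2 s) (\<lambda>c. c + B (vec_first x r) c) (vec_last x s) @\<^sub>v 0\<^sub>v m"

lemma address_append_eq_iff:
  assumes t: "t \<in> F2 r" and z: "z \<in> F2 s" and c: "c \<in> F2 s"
  shows "address m (t @\<^sub>v z) = c @\<^sub>v w \<longleftrightarrow> z = c + B t c \<and> w = 0\<^sub>v m"
proof -
  let ?h = "\<lambda>c. c + B t c"
  have bij: "bij_betw ?h (F2 s) (F2 s)" by (rule shear_bij[OF t])
  have "inv_into (F2 s) ?h z \<in> F2 s" using z bij by (metis bij_betw_def inv_into_into)
  then have "address m (t @\<^sub>v z) = c @\<^sub>v w \<longleftrightarrow> inv_into (F2 s) ?h z = c \<and> 0\<^sub>v m = w"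
    using t z c unfolding address_def by (simp add: append_vec_eq[of _ s])
  moreover have "inv_into (F2 s) ?h z = c \<longleftrightarrow> z = ?h c"
    using bij_betw_inv_into_right[OF bij z] bij_betw_inv_into_left[OF bij c] by auto
  ultimately show ?thesis by auto
qed

lemma address_closed: "x \<in> F2 (r + s) \<Longrightarrow> address m x \<in> F2 (s + m)"
  using shear_bij[of "vec_first x r"] unfolding address_def
  by (intro append_carrier_vec zero_carrier_vec) (metis bij_betw_def inv_into_into vec_first_carrier vec_last_carrier)

definition frequency :: "nat \<Rightarrow> bit vec \<Rightarrow> bit vec \<Rightarrow> bit vec" where
  "frequency m c z = (\<beta> c z @\<^sub>v z) @\<^sub>v (c @\<^sub>v 0\<^sub>v m)"

lemma frequency_eq_iff:
  assumes "c \<in> F2 s" "z \<in> F2 s" "\<tau> \<in> F2 r" "z' \<in> F2 s" "c' \<in> F2 s"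
  shows "frequency m c z = (\<tau> @\<^sub>v z') @\<^sub>v (c' @\<^sub>v w) \<longleftrightarrow> \<tau> = \<beta> c z \<and> z = z' \<and> c = c' \<and> w = 0\<^sub>v m"
  using assms \<beta>_closed[of c z]
  by (auto simp: frequency_def append_vec_eq[of _ "r + s"] append_vec_eq[of _ r] append_vec_eq[of _ s])

text \<open>For \<open>w\<close> zero, the \<open>x\<close> that select \<open>c\<close> form the
  piece (t, c + B t c), and the coefficient is a character sum over \<open>t\<close> with frequency
  \<open>\<tau> + \<beta> c z\<close>. For other \<open>w\<close> no \<open>x\<close> is
  selected.\<close>

lemma fourier_coeff_address:
  assumes \<tau>: "\<tau> \<in> F2 r" and z: "z \<in> F2 s" and c: "c \<in> F2 s" and w: "w \<in> F2 m"
  shows "fourier_coeff (r + s + (s + m)) (addressing (r + s) (s + m) (address m))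
      ((\<tau> @\<^sub>v z) @\<^sub>v (c @\<^sub>v w)) \<noteq> 0 \<longleftrightarrow> \<tau> = \<beta> c z \<and> w = 0\<^sub>v m"
proof -
  let ?X = "{x \<in> F2 (r + s). address m x = c @\<^sub>v w}"
  have "(\<Sum>x\<in>?X. bsign (x \<bullet> (\<tau> @\<^sub>v z))) \<noteq> 0 \<longleftrightarrow> \<tau> = \<beta> c z \<and> w = 0\<^sub>v m"
  proof (cases "w = 0\<^sub>v m")
    case True
    have X: "?X = (\<lambda>t. t @\<^sub>v (c + B t c)) ` F2 r"
      using True c B_closed
      by (auto simp: address_append_eq_iff elim!: carrier_vec_addE intro!: append_carrier_vec)
    have inj: "inj_on (\<lambda>t. t @\<^sub>v (c + B t c)) (F2 r)"
      by (rule inj_onI) (simp add: append_vec_eq[of _ r])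
    \<comment> \<open>The adjoint turns \<open>B t c \<bullet> z\<close> into
      \<open>t \<bullet> \<beta> c z\<close>, which merges with the term from \<tau>; the sign of
      \<open>c \<bullet> z\<close> does not depend on \<open>t\<close>.\<close>
    have "(\<Sum>x\<in>?X. bsign (x \<bullet> (\<tau> @\<^sub>v z))) = (\<Sum>t\<in>F2 r. bsign (c \<bullet> z) * bsign (t \<bullet> (\<tau> + \<beta> c z)))"
      unfolding X sum.reindex[OF inj] o_def
    proof (rule sum.cong[OF refl])
      fix t assume t: "t \<in> F2 r"
      show "bsign ((t @\<^sub>v (c + B t c)) \<bullet> (\<tau> @\<^sub>v z)) = bsign (c \<bullet> z) * bsign (t \<bullet> (\<tau> + \<beta> c z))"
        using t c z \<tau> B_closed[OF t c] \<beta>_closed[OF c z]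
        by (simp add: scalar_prod_append[of _ r _ s] scalar_prod_add_distrib[of _ r]
            add_scalar_prod_distrib[of _ s] \<beta>_adjoint bsign_add del: add_bit_eq_xor)
    qed
    then show ?thesis
      using True \<tau> c z \<beta>_closed[OF c z] bsign_range[of "c \<bullet> z"]
      by (auto simp: sum_bsign_scalar_prod F2_add_eq_0_iff[of _ r] simp flip: sum_distrib_left)
  next
    case False
    then have empty: "?X = {}"
      using c by (auto simp: address_append_eq_iff elim!: carrier_vec_addE)
    show ?thesis unfolding empty using False by simp
  qed
  then show ?thesis
    using assms by (subst fourier_coeff_addressing) (auto simp: address_closed)
qed

lemma fourier_supp_address:
  "fourier_supp (r + s + (s + m)) (addressing (r + s) (s + m) (address m))
    = (\<lambda>(c, z). frequency m c z) ` (F2 s \<times> F2 s)" (is "?S = ?R")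
proof (intro equalityI subsetI)
  fix x assume x: "x \<in> ?S"
  then have "x \<in> F2 (r + s + (s + m))" by (simp add: fourier_supp_def)
  then obtain \<tau> z c w where dec: "x = (\<tau> @\<^sub>v z) @\<^sub>v (c @\<^sub>v w)"
      "\<tau> \<in> F2 r" "z \<in> F2 s" "c \<in> F2 s" "w \<in> F2 m"
    by (metis carrier_vec_addE)
  with x have "\<tau> = \<beta> c z \<and> w = 0\<^sub>v m"
    using fourier_coeff_address[OF dec(2-5)] by (simp add: fourier_supp_def)
  then show "x \<in> ?R" using dec by (force simp: frequency_def)
next
  fix x assume "x \<in> ?R"
  then obtain c z where "x = frequency m c z" "c \<in> F2 s" "z \<in> F2 s" by auto
  then show "x \<in> ?S"
    using fourier_coeff_address[of "\<beta> c z" z c "0\<^sub>v m" m] \<beta>_closed[of c z]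
    by (auto simp: fourier_supp_def frequency_def intro!: append_carrier_vec)
qed

text \<open>Both \<open>c\<close> and \<open>z\<close> are blocks of \<open>frequency m c z\<close>,
  so distinct pairs give distinct frequencies.\<close>

lemma card_fourier_supp_address:
  "card (fourier_supp (r + s + (s + m)) (addressing (r + s) (s + m) (address m))) = 2 ^ (2 * s)"
proof -
  have "inj_on (\<lambda>(c, z). frequency m c z) (F2 s \<times> F2 s)"
  proof (rule inj_onI, clarify)
    fix c z c' z' assume c: "c \<in> F2 s" "z \<in> F2 s" "c' \<in> F2 s" "z' \<in> F2 s"
      and eq: "frequency m c z = frequency m c' z'"
    from eq[unfolded frequency_def[of m c' z']]
    show "c = c' \<and> z = z'"
      unfolding frequency_eq_iff[OF c(1,2) \<beta>_closed[OF c(3,4)] c(4,3)] by blast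
  qed
  then show ?thesis
    unfolding fourier_supp_address by (simp add: card_image card_cartesian_product card_F2 mult_2 power_add)
qed

section \<open>Intersections of two translates of the support\<close>

text \<open>A common point determines a solution (c, z) of the equation counted in
  \<open>card_\<beta>_fibre\<close>, and is determined by it. If the shifts agree in the
  \<open>c\<close> and \<open>z\<close> blocks, that count does not apply, but then the translates
  are disjoint.\<close>

lemma card_translates_inter:
  assumes \<gamma>: "\<gamma>\<^sub>1 \<in> F2 (r + s + (s + m))" "\<gamma>\<^sub>2 \<in> F2 (r + s + (s + m))" "\<gamma>\<^sub>1 \<noteq> \<gamma>\<^sub>2"
  defines "S \<equiv> fourier_supp (r + s + (s + m)) (addressing (r + s) (s + m) (address m))"
  shows "2 ^ r * card (translate S \<gamma>\<^sub>1 \<inter> translate S \<gamma>\<^sub>2) \<le> 2 ^ (2 * s)"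
proof -
  obtain t1 z1 c1 w1 where \<gamma>1: "\<gamma>\<^sub>1 = (t1 @\<^sub>v z1) @\<^sub>v (c1 @\<^sub>v w1)"
      "t1 \<in> F2 r" "z1 \<in> F2 s" "c1 \<in> F2 s" "w1 \<in> F2 m"
    using \<gamma>(1) by (metis carrier_vec_addE)
  obtain t2 z2 c2 w2 where \<gamma>2: "\<gamma>\<^sub>2 = (t2 @\<^sub>v z2) @\<^sub>v (c2 @\<^sub>v w2)"
      "t2 \<in> F2 r" "z2 \<in> F2 s" "c2 \<in> F2 s" "w2 \<in> F2 m"
    using \<gamma>(2) by (metis carrier_vec_addE)
  \<comment> \<open>The constant \<open>a\<close> collects the terms of the first block that depend
    only on the two shifts.\<close>
  define dc dz a where "dc = c1 + c2" and "dz = z1 + z2" and "a = (t1 + t2) + \<beta> dc dz"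
  let ?A = "{(c, z) \<in> F2 s \<times> F2 s. \<beta> c dz + \<beta> dc z = a}"
  have carrier: "dc \<in> F2 s" "dz \<in> F2 s" "a \<in> F2 r"
    using \<gamma>1 \<gamma>2 by (auto simp: dc_def dz_def a_def \<beta>_closed)
  \<comment> \<open>The middle blocks force c' = c + dc and z' = z + dz. Expanding the first block
    and cancelling \<open>\<beta> c z\<close> leaves an equation that is affine in (c, z).\<close>
  have key: "w1 = w2 \<and> \<beta> c dz + \<beta> dc z = a"
    if c: "c \<in> F2 s" "c' \<in> F2 s" "z \<in> F2 s" "z' \<in> F2 s"
      and eq: "frequency m c z + \<gamma>\<^sub>1 = frequency m c' z' + \<gamma>\<^sub>2" for c z c' z'
  proof -
    have add: "frequency m c z + ((t @\<^sub>v y) @\<^sub>v (d @\<^sub>v w))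
        = ((\<beta> c z + t) @\<^sub>v (z + y)) @\<^sub>v ((c + d) @\<^sub>v w)"
      if "c \<in> F2 s" "z \<in> F2 s" "t \<in> F2 r" "y \<in> F2 s" "d \<in> F2 s" "w \<in> F2 m" for c z t y d w
      using that \<beta>_closed[of c z] unfolding frequency_def
      by (simp add: append_vec_add[of _ "r + s" _ _ "s + m"] append_vec_add[of _ r _ _ s]
          append_vec_add[of _ s _ _ m])
    have "\<beta> c z + t1 = \<beta> c' z' + t2 \<and> z + z1 = z' + z2 \<and> c + c1 = c' + c2 \<and> w1 = w2"
      using eq c \<gamma>1 \<gamma>2 \<beta>_closed[of c z] \<beta>_closed[of c' z']
      by (simp add: add append_vec_eq[of _ "r + s"] append_vec_eq[of _ r] append_vec_eq[of _ s])
    then have *: "\<beta> c z + t1 = \<beta> c' z' + t2" "z + z1 = z' + z2" "c + c1 = c' + c2" "w1 = w2"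
      by auto
    have c': "c' = c + dc" "z' = z + dz"
      using *(2,3) c \<gamma>1 \<gamma>2 unfolding dc_def dz_def
      by (auto intro: F2_add_eq_addD)
    have "\<beta> c z + t1 = \<beta> c z + (\<beta> c dz + \<beta> dc z) + \<beta> dc dz + t2"
      using *(1) c carrier unfolding c' by (simp add: \<beta>_add_add)
    then have "\<beta> c dz + \<beta> dc z = a"
      unfolding a_def
      by (rule F2_add_solve[where n = r]) (use c carrier \<gamma>1(2) \<gamma>2(2) \<beta>_closed in auto)
    with * show ?thesis by simp
  qed
  have card_le: "card (translate S \<gamma>\<^sub>1 \<inter> translate S \<gamma>\<^sub>2) \<le> card ?A"
  proof (rule surj_card_le)
    show "finite ?A" by (rule finite_subset[of _ "F2 s \<times> F2 s"]) (auto simp: finite_F2)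
    show "translate S \<gamma>\<^sub>1 \<inter> translate S \<gamma>\<^sub>2 \<subseteq> (\<lambda>(c, z). frequency m c z + \<gamma>\<^sub>1) ` ?A"
    proof
      fix x assume "x \<in> translate S \<gamma>\<^sub>1 \<inter> translate S \<gamma>\<^sub>2"
      then obtain c z c' z' where c: "c \<in> F2 s" "c' \<in> F2 s" "z \<in> F2 s" "z' \<in> F2 s"
        and x: "x = frequency m c z + \<gamma>\<^sub>1" "x = frequency m c' z' + \<gamma>\<^sub>2"
        unfolding S_def fourier_supp_address translate_def by auto
      then have "(c, z) \<in> ?A" using key[of c c' z z'] by simp
      then show "x \<in> (\<lambda>(c, z). frequency m c z + \<gamma>\<^sub>1) ` ?A"
        by (rule rev_image_eqI) (simp add: x(1))
    qed
  qed
  show ?thesis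
  proof (cases "dc = 0\<^sub>v s \<and> dz = 0\<^sub>v s")
    case False
    then have "2 ^ r * card ?A = 2 ^ (2 * s)"
      using carrier by (intro card_\<beta>_fibre) auto
    then show ?thesis using mult_le_mono2[OF card_le, of "2 ^ r"] by (simp only:)
  next
    case True
    then have eqs: "c1 = c2" "z1 = z2"
      using \<gamma>1 \<gamma>2 by (auto simp: dc_def dz_def F2_add_eq_0_iff)
    have "translate S \<gamma>\<^sub>1 \<inter> translate S \<gamma>\<^sub>2 = {}"
    proof (rule ccontr)
      assume "\<not> ?thesis"
      then obtain c z c' z' where c: "c \<in> F2 s" "c' \<in> F2 s" "z \<in> F2 s" "z' \<in> F2 s"
        and "frequency m c z + \<gamma>\<^sub>1 = frequency m c' z' + \<gamma>\<^sub>2"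
        unfolding S_def fourier_supp_address translate_def by auto
      from key[OF this] have w: "w1 = w2" and a: "\<beta> c (0\<^sub>v s) + \<beta> (0\<^sub>v s) z = a"
        using True by auto
      have z0: "\<beta> c (0\<^sub>v s) = 0\<^sub>v r" "\<beta> (0\<^sub>v s) z = 0\<^sub>v r"
        using \<beta>_add_left[of "0\<^sub>v s" "0\<^sub>v s" z] \<beta>_add_right[of c "0\<^sub>v s" "0\<^sub>v s"] c
          \<beta>_closed[of c "0\<^sub>v s"] \<beta>_closed[of "0\<^sub>v s" z]
        by (simp_all add: F2_add_self)
      \<comment> \<open>With \<open>dc\<close> and \<open>dz\<close> zero every \<beta> term
        vanishes, so a common point would make the two shifts agree in all four blocks.\<close>
      have "t1 + t2 = 0\<^sub>v r"
        using a True \<gamma>1 \<gamma>2 by (simp add: z0 a_def \<beta>_zero)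
      then have "t1 = t2" using F2_add_eq_0_iff \<gamma>1 \<gamma>2 by metis
      then show False using \<gamma>(3) \<gamma>1 \<gamma>2 w eqs by simp
    qed
    then show ?thesis by simp
  qed
qed

end

section \<open>Multiplication modulo an irreducible polynomial\<close>

definition poly_of_bits :: "bit vec \<Rightarrow> bit poly" where
  "poly_of_bits v = Abs_poly (\<lambda>i. if i < dim_vec v then v $ i else 0)"

lemma coeff_poly_of_bits: "coeff (poly_of_bits v) i = (if i < dim_vec v then v $ i else 0)"
  unfolding poly_of_bits_def
  by (subst coeff_Abs_poly[of "dim_vec v"]) auto

lemma poly_of_bits_add: "u \<in> F2 n \<Longrightarrow> v \<in> F2 n \<Longrightarrow> poly_of_bits (u + v) = poly_of_bits u + poly_of_bits v"
  by (rule poly_eqI) (simp add: coeff_poly_of_bits del: add_bit_eq_xor)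

lemma degree_poly_of_bits_less: "v \<in> F2 n \<Longrightarrow> n > 0 \<Longrightarrow> degree (poly_of_bits v) < n"
  by (rule le_less_trans[OF degree_le[of "n - 1"]]) (auto simp: coeff_poly_of_bits)

lemma poly_of_bits_eq_0_iff: "v \<in> F2 n \<Longrightarrow> poly_of_bits v = 0 \<longleftrightarrow> v = 0\<^sub>v n"
  by (auto simp: poly_eq_iff coeff_poly_of_bits)

definition bits_of_poly :: "nat \<Rightarrow> bit poly \<Rightarrow> bit vec" where
  "bits_of_poly n p = vec n (coeff p)"

lemma bits_of_poly_closed: "bits_of_poly n p \<in> F2 n"
  by (simp add: bits_of_poly_def)

lemma bits_of_poly_add: "bits_of_poly n (p + q) = bits_of_poly n p + bits_of_poly n q"
  by (rule eq_vecI) (simp_all add: bits_of_poly_def del: add_bit_eq_xor)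

lemma poly_of_bits_of_poly: "degree p < n \<Longrightarrow> poly_of_bits (bits_of_poly n p) = p"
  by (rule poly_eqI) (simp add: coeff_poly_of_bits bits_of_poly_def coeff_eq_0)

text \<open>The leading \<open>pCons 0\<close> multiplies by X. It keeps the constant 1 out of the
  multipliers X t, so that no multiplication has a nonzero fixpoint.\<close>

definition mod_mult :: "bit poly \<Rightarrow> bit vec \<Rightarrow> bit vec \<Rightarrow> bit vec" where
  "mod_mult P t c = bits_of_poly (degree P) (pCons 0 (poly_of_bits t) * poly_of_bits c mod P)"

text \<open>An irreducible polynomial over a field is prime, and it divides no nonzero polynomial of
  smaller degree.\<close>

lemma irreducible_not_dvd_mult:
  fixes P :: "'a :: field poly"
  assumes "irreducible P" "a \<noteq> 0" "degree a < degree P" "b \<noteq> 0" "degree b < degree P"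
  shows "\<not> P dvd a * b"
proof
  assume "P dvd a * b"
  then have "P dvd a \<or> P dvd b"
    using field_poly_irreducible_imp_prime[OF assms(1)] by (simp add: prime_elem_dvd_mult_iff)
  then show False using assms dvd_imp_degree_le by (metis linorder_not_less)
qed

lemma pCons_neg_1_mult: "pCons (- 1) p * q = pCons 0 p * q - q" for p q :: "'a :: comm_ring_1 poly"
  by simp

text \<open>Both X t and X t - 1 have degree at most \<open>r\<close>, hence below that of
  \<open>P\<close>. The first is nonzero for nonzero \<open>t\<close>, the second always because of
  its constant term, so neither annihilates a nonzero residue.\<close>

lemma nonsingular_bilinear_mod_mult:
  assumes irr: "irreducible P" and r: "r < degree P"
  shows "nonsingular_bilinear r (degree P) (mod_mult P)"
proof -
  have deg: "degree (p mod P) < degree P" for p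
    using irr r degree_mod_less[of P p] by (cases "p mod P = 0") auto
  have poly_mod_mult: "poly_of_bits (mod_mult P t c) = pCons 0 (poly_of_bits t) * poly_of_bits c mod P" for t c
    unfolding mod_mult_def using deg by (rule poly_of_bits_of_poly)
  \<comment> \<open>The zero polynomial is a separate alternative because its degree 0 is not below
    \<open>r\<close> when \<open>r = 0\<close>.\<close>
  have deg_t: "degree (poly_of_bits t) < r \<or> poly_of_bits t = 0" if "t \<in> F2 r" for t
    using degree_poly_of_bits_less[OF that] poly_of_bits_eq_0_iff[OF that] that by (cases "r = 0") auto
  have deg_c: "degree (poly_of_bits c) < degree P" if "c \<in> F2 (degree P)" for c
    using degree_poly_of_bits_less[OF that] r by simp
  have pCons0_add: "pCons 0 (p + q) = pCons 0 p + pCons 0 q" for p q :: "bit poly" by simp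
  show ?thesis
  proof
    fix t c assume t: "t \<in> F2 r" and c: "c \<in> F2 (degree P)"
    show "mod_mult P t c \<in> F2 (degree P)" by (simp add: mod_mult_def bits_of_poly_closed)
    show "mod_mult P (t + t') c = mod_mult P t c + mod_mult P t' c" if "t' \<in> F2 r" for t'
      by (simp only: mod_mult_def poly_of_bits_add[OF t that] pCons0_add poly_mod_add_left
          distrib_right bits_of_poly_add)
    show "mod_mult P t (c + c') = mod_mult P t c + mod_mult P t c'" if "c' \<in> F2 (degree P)" for c'
      using c that
      by (simp only: mod_mult_def poly_of_bits_add[of _ "degree P"] poly_mod_add_left distrib_left
          bits_of_poly_add)
    show "t = 0\<^sub>v r \<or> c = 0\<^sub>v (degree P)" if "mod_mult P t c = 0\<^sub>v (degree P)"
    proof (rule ccontr)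
      assume "\<not> ?thesis"
      then have nz: "poly_of_bits t \<noteq> 0" "poly_of_bits c \<noteq> 0"
        using t c by (auto simp: poly_of_bits_eq_0_iff)
      have "P dvd pCons 0 (poly_of_bits t) * poly_of_bits c"
        using that poly_mod_mult[of t c] poly_of_bits_eq_0_iff[of "0\<^sub>v (degree P)" "degree P"]
        by (simp add: mod_eq_0_iff_dvd)
      moreover have "degree (pCons 0 (poly_of_bits t)) < degree P"
        using deg_t[OF t] nz r by simp
      ultimately show False
        using irreducible_not_dvd_mult[OF irr _ _ nz(2) deg_c[OF c]] nz(1) by (metis pCons_eq_0_iff)
    qed
    show "c = 0\<^sub>v (degree P)" if "mod_mult P t c = c"
    proof (rule ccontr)
      assume "\<not> ?thesis"
      then have nz: "poly_of_bits c \<noteq> 0" using c by (auto simp: poly_of_bits_eq_0_iff)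
      have "pCons 0 (poly_of_bits t) * poly_of_bits c mod P = poly_of_bits c mod P"
        using that poly_mod_mult[of t c] deg_c[OF c] by (simp add: mod_poly_less)
      then have "P dvd pCons 0 (poly_of_bits t) * poly_of_bits c - poly_of_bits c"
        by (simp only: poly_mod_diff_left diff_self mod_0_imp_dvd)
      then have "P dvd pCons (- 1) (poly_of_bits t) * poly_of_bits c"
        unfolding pCons_neg_1_mult .
      moreover have "degree (pCons (- 1) (poly_of_bits t)) < degree P"
        using deg_t[OF t] r by auto
      ultimately show False
        using irreducible_not_dvd_mult[OF irr _ _ nz deg_c[OF c]]
        by (metis neg_equal_0_iff_equal one_neq_zero pCons_eq_0_iff)
    qed
  qed
qed

theorem theorem3p1:
  fixes k n :: nat
  assumes "k \<ge> 3" and "n = 2 ^ k + 7 * k"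
  shows "\<exists>f \<in> F2 n \<rightarrow> {-1, 1 :: real}.
           let S = fourier_supp n f in
             card S \<ge> 2 ^ (6 * k) \<and>
             (\<forall>\<gamma>\<^sub>1 \<in> F2 n. \<forall>\<gamma>\<^sub>2 \<in> F2 n. \<gamma>\<^sub>1 \<noteq> \<gamma>\<^sub>2 \<longrightarrow>
                card (translate S \<gamma>\<^sub>1 \<inter> translate S \<gamma>\<^sub>2) \<le> 2 ^ (5 * k + 4))"
proof -
  \<comment> \<open>Degree 3k gives a support of size 2^(2 * 3k) = 2^(6k), while \<open>t\<close> in
    dimension k cuts intersections down by the factor 2^k.\<close>
  obtain P :: "bit poly" where P: "irreducible P" "degree P = 3 * k"
    using exists_irreducible_bit_poly[of "3 * k"] assms(1) by auto
  interpret nonsingular_bilinear k "3 * k" "mod_mult P"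
    using nonsingular_bilinear_mod_mult[OF P(1), of k] P(2) assms(1) by simp
  \<comment> \<open>The blocks are \<open>t\<close>, \<open>z\<close>, \<open>y\<close> and the 2^k
    dummy coordinates \<open>w\<close>.\<close>
  have n: "n = k + 3 * k + (3 * k + 2 ^ k)" using assms(2) by simp
  define f where "f = addressing (k + 3 * k) (3 * k + 2 ^ k) (address (2 ^ k))"
  have "f \<in> F2 n \<rightarrow> {-1, 1}" unfolding f_def addressing_def using bsign_range by blast
  moreover have "card (fourier_supp n f) = 2 ^ (6 * k)"
    using card_fourier_supp_address[of "2 ^ k"] by (simp add: n f_def)
  moreover have "card (translate (fourier_supp n f) \<gamma>\<^sub>1 \<inter> translate (fourier_supp n f) \<gamma>\<^sub>2)
      \<le> 2 ^ (5 * k + 4)" (is "?c \<le> _") if "\<gamma>\<^sub>1 \<in> F2 n" "\<gamma>\<^sub>2 \<in> F2 n" "\<gamma>\<^sub>1 \<noteq> \<gamma>\<^sub>2" for \<gamma>\<^sub>1 \<gamma>\<^sub>2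
  proof -
    have "2 ^ k * ?c \<le> 2 ^ (2 * (3 * k))"
      using card_translates_inter[of \<gamma>\<^sub>1 "2 ^ k" \<gamma>\<^sub>2] that unfolding n f_def .
    also have "(2 :: nat) ^ (2 * (3 * k)) = 2 ^ k * 2 ^ (5 * k)" by (simp flip: power_add)
    finally have "?c \<le> 2 ^ (5 * k)" by simp
    also have "\<dots> \<le> 2 ^ (5 * k + 4)" by (rule power_increasing) auto
    finally show ?thesis .
  qed
  ultimately show ?thesis unfolding Let_def by (intro bexI[of _ f]) auto
qed

end
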